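(* Let $M$ be an Euler magic matrix of order $n$ (over $\mathbb{R}$) with constant $\gamma$, and let $N$ be obtained from $M$ by any product of mirror-pair Givens rotations applied on the left and/or the right, i.e. $N=G_1\cdots G_p\,M\,H_1\cdots H_q$ with $p,q\ge 0$ and each $G_i,H_j\in\mathbb{R}^{n\times n}$ a Givens rotation supported on some mirror pair (the mirror pairs may vary). Then $NN^{t}=\gamma I_n$ and $D(N)+A(N)=2\gamma$; consequently, $N$ is Euler magic (over $\mathbb{R}$) with constant $\gamma$ if and only if $D(N)=A(N)$.
   Context: Let $R$ be a subring of $\mathbb{R}$ and $n\ge 1$. A matrix $M=(m_{ij})\in R^{n\times n}$ is an Euler magic matrix of order $n$ over $R$ with constant $\gamma\in R\setminus\{0\}$ if $MM^{t}=\gamma I_n$, $\sum_{k=1}^{n} m_{kk}^{2}=\gamma$, and $\sum_{k=1}^{n} m_{k,\,n+1-k}^{2}=\gamma$. For $M=(m_{ij})\in\mathbb{R}^{n\times n}$ put $D(M)=\sum_{i=1}^{n} m_{ii}^{2}$ and $A(M)=\sum_{i=1}^{n} m_{i,\,n+1-i}^{2}$, so the last two conditions read $D(M)=A(M)=\gamma$. For $a\in\{1,\dots,n\}$ put $a^{*}=n+1-a$. A mirror pair is a set $\{a,a^{*}\}$ with $a\ne a^{*}$. A Givens rotation supported on $\{a,a^{*}\}$ is an $n\times n$ real matrix that equals the identity matrix outside rows and columns $a,a^{*}$, and whose $2\times 2$ block on rows and columns $a,a^{*}$ is $\begin{pmatrix} c & -s\\ s & c\end{pmatrix}$ with $c,s\in\mathbb{R}$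 and $c^{2}+s^{2}=1$; i.e. $G_{aa}=G_{a^{*}a^{*}}=c$, $G_{aa^{*}}=-s$, $G_{a^{*}a}=s$. *)

theory Defs
  imports Complex_Main "Jordan_Normal_Form.Matrix"
begin

text \<open>
  Matrices have type \<^typ>\<open>real mat\<close>, whose rows and columns are numbered from \<open>0\<close>. The index
  \<open>a \<in> {1, \<dots>, n}\<close> of the mathematical text corresponds to \<open>a - 1\<close> here, so the reflection
  \<open>a \<mapsto> n + 1 - a\<close> becomes \<open>i \<mapsto> n - 1 - i\<close> on \<open>{0, \<dots>, n - 1}\<close>.
\<close>

definition mirror :: "nat \<Rightarrow> nat \<Rightarrow> nat" where
  "mirror n i = n - 1 - i"

definition diag_sq :: "real mat \<Rightarrow> real" where
  "diag_sq M = (\<Sum>i<dim_row M. (M $$ (i, i))\<^sup>2)"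

definition antidiag_sq :: "real mat \<Rightarrow> real" where
  "antidiag_sq M = (\<Sum>i<dim_row M. (M $$ (i, mirror (dim_row M) i))\<^sup>2)"

definition real_subring :: "real set \<Rightarrow> bool" where
  "real_subring R \<longleftrightarrow> 1 \<in> R \<and> (\<forall>x\<in>R. \<forall>y\<in>R. x - y \<in> R \<and> x * y \<in> R)"

definition euler_magic :: "real set \<Rightarrow> nat \<Rightarrow> real \<Rightarrow> real mat \<Rightarrow> bool" where
  "euler_magic R n \<gamma> M \<longleftrightarrow>
     real_subring R \<and> n \<ge> 1 \<and> \<gamma> \<in> R - {0} \<and>
     M \<in> carrier_mat n n \<and> elements_mat M \<subseteq> R \<and>
     M * transpose_mat M = \<gamma> \<cdot>\<^sub>m 1\<^sub>m n \<and>
     diag_sq M = \<gamma> \<and> antidiag_sq M = \<gamma>"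

definition givens :: "nat \<Rightarrow> nat \<Rightarrow> real \<Rightarrow> real \<Rightarrow> real mat" where
  "givens n a c s = mat n n (\<lambda>(i, j).
     if (i, j) = (a, a) \<or> (i, j) = (mirror n a, mirror n a) then c
     else if (i, j) = (a, mirror n a) then - s
     else if (i, j) = (mirror n a, a) then s
     else if i = j then 1 else 0)"

definition mirror_givens :: "nat \<Rightarrow> real mat \<Rightarrow> bool" where
  "mirror_givens n G \<longleftrightarrow>
     (\<exists>a c s. a < n \<and> a \<noteq> mirror n a \<and> c\<^sup>2 + s\<^sup>2 = 1 \<and> G = givens n a c s)"

definition mat_prod_list :: "nat \<Rightarrow> real mat list \<Rightarrow> real mat" where
  "mat_prod_list n Gs = foldr (*) Gs (1\<^sub>m n)"

end

theory Submission imports Defs begin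

text \<open>
  Grouping the sum \<open>D + A\<close> by columns gives \<open>\<Sum>\<^sub>j (m\<^bsub>jj\<^esub>\<^sup>2 + m\<^bsub>j*j\<^esub>\<^sup>2)\<close>. A rotation applied on the left acts,
  within each column, on the pair of rows \<open>a, a*\<close>, so it preserves every summand. Transposition
  exchanges rows and columns and fixes \<open>D + A\<close>, which settles rotations applied on the right.
\<close>

lemma mirror_less: "i < n \<Longrightarrow> mirror n i < n"
  by (auto simp: mirror_def)

text \<open>The bound matters because subtraction on \<open>nat\<close> truncates: every
  \<open>i \<ge> n\<close> is sent to 0, where the reflection cannot be undone.\<close>

lemma mirror_mirror: "i < n \<Longrightarrow> mirror n (mirror n i) = i"
  by (auto simp: mirror_def)

lemma mirror_eq_iff: "i < n \<Longrightarrow> j < n \<Longrightarrow> mirror n i = j \<longleftrightarrow> i = mirror n j"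
  by (auto simp: mirror_def)

lemma givens_carrier [simp]: "givens n a c s \<in> carrier_mat n n"
  by (simp add: givens_def)

text \<open>The inverse rotation has the opposite angle, so the class of mirror rotations is closed
  under transposition; this carries results about left factors over to right factors.\<close>

lemma transpose_givens:
  assumes "a < n" "a \<noteq> mirror n a"
  shows "transpose_mat (givens n a c s) = givens n a c (- s)"
  using assms by (intro eq_matI) (auto simp: givens_def)

text \<open>Row \<open>i\<close> of the rotation is supported on the columns \<open>a\<close> and
  \<open>mirror n a\<close> if \<open>i\<close> is one of these two indices, and on column
  \<open>i\<close> alone otherwise, so the scalar product collapses to at most two terms.\<close>

lemma index_givens_mult:
  assumes "a < n" "a \<noteq> mirror n a" "M \<in> carrier_mat n m" "i < n" "j < m"
  shows "(givens n a c s * M) $$ (i, j) =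
    (if i = a then c * M $$ (a, j) - s * M $$ (mirror n a, j)
     else if i = mirror n a then s * M $$ (a, j) + c * M $$ (mirror n a, j)
     else M $$ (i, j))"
proof -
  let ?b = "mirror n a"
  let ?G = "givens n a c s"
  have b: "?b < n" using assms(1) by (rule mirror_less)
  have prod: "(?G * M) $$ (i, j) = (\<Sum>k\<in>{0..<n}. ?G $$ (i, k) * M $$ (k, j))"
    using assms by (simp add: scalar_prod_def givens_def)
  show ?thesis
  proof (cases "i = a \<or> i = ?b")
    case True
    have "(\<Sum>k\<in>{0..<n}. ?G $$ (i, k) * M $$ (k, j)) = (\<Sum>k\<in>{a, ?b}. ?G $$ (i, k) * M $$ (k, j))"
      using assms b True by (intro sum.mono_neutral_right) (auto simp: givens_def)
    then show ?thesis
      using assms b True prod by (auto simp: givens_def)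
  next
    case False
    have "(\<Sum>k\<in>{0..<n}. ?G $$ (i, k) * M $$ (k, j)) = (\<Sum>k\<in>{i}. ?G $$ (i, k) * M $$ (k, j))"
      using assms b False by (intro sum.mono_neutral_right) (auto simp: givens_def)
    then show ?thesis
      using assms b False prod by (auto simp: givens_def)
  qed
qed

lemma mirror_givens_carrier: "mirror_givens n G \<Longrightarrow> G \<in> carrier_mat n n"
  by (auto simp: mirror_givens_def)

lemma mirror_givens_transpose:
  assumes "mirror_givens n G"
  shows "mirror_givens n (transpose_mat G)"
proof -
  obtain a c s where G: "a < n" "a \<noteq> mirror n a" "c\<^sup>2 + s\<^sup>2 = 1" "G = givens n a c s"
    using assms by (auto simp: mirror_givens_def)
  then have "transpose_mat G = givens n a c (- s)" "c\<^sup>2 + (- s)\<^sup>2 = 1"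
    by (simp_all add: transpose_givens)
  with G(1,2) show ?thesis unfolding mirror_givens_def by blast
qed

lemma mirror_givens_orthogonal:
  assumes "mirror_givens n G"
  shows "G * transpose_mat G = 1\<^sub>m n"
proof -
  obtain a c s where G: "a < n" "a \<noteq> mirror n a" "c\<^sup>2 + s\<^sup>2 = 1" "G = givens n a c s"
    using assms by (auto simp: mirror_givens_def)
  \<comment> \<open>Inside the rotated block the diagonal entries become
    \<open>c\<^sup>2 + s\<^sup>2 = 1\<close> and the mixed terms cancel.\<close>
  have "givens n a c s * givens n a c (- s) = 1\<^sub>m n"
  proof (rule eq_matI)
    fix i j assume "i < dim_row (1\<^sub>m n :: real mat)" "j < dim_col (1\<^sub>m n :: real mat)"
    then show "(givens n a c s * givens n a c (- s)) $$ (i, j) = 1\<^sub>m n $$ (i, j)"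
      using G(1-3) mirror_less[OF G(1)]
      by (subst index_givens_mult[where m = n]) (auto simp: givens_def power2_eq_square algebra_simps)
  qed (auto simp: givens_def)
  with G show ?thesis by (simp add: transpose_givens)
qed

lemma diag_sq_transpose:
  "M \<in> carrier_mat n n \<Longrightarrow> diag_sq (transpose_mat M) = diag_sq M"
  by (auto simp: diag_sq_def intro!: sum.cong)

lemma antidiag_sq_transpose:
  assumes "M \<in> carrier_mat n n"
  shows "antidiag_sq (transpose_mat M) = antidiag_sq M"
proof -
  have "antidiag_sq (transpose_mat M) = (\<Sum>i<n. (M $$ (mirror n i, i))\<^sup>2)"
    using assms by (auto simp: antidiag_sq_def mirror_less intro!: sum.cong)
  also have "\<dots> = (\<Sum>i<n. (M $$ (i, mirror n i))\<^sup>2)"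
    by (rule sum.reindex_bij_witness[where i = "mirror n" and j = "mirror n"])
      (auto simp: mirror_less mirror_mirror)
  finally show ?thesis using assms by (simp add: antidiag_sq_def)
qed

text \<open>Column \<open>j\<close> now contributes its entries in two mirrored rows, which a left
  mirror rotation either mixes with each other or leaves alone.\<close>

lemma diag_antidiag_sq_columns:
  assumes "M \<in> carrier_mat n n"
  shows "diag_sq M + antidiag_sq M = (\<Sum>j<n. (M $$ (j, j))\<^sup>2 + (M $$ (mirror n j, j))\<^sup>2)"
proof -
  have "antidiag_sq M = (\<Sum>j<n. (M $$ (mirror n j, j))\<^sup>2)"
    using assms
    by (subst antidiag_sq_transpose[symmetric])
      (auto simp: antidiag_sq_def mirror_less intro!: sum.cong)
  then show ?thesis using assms by (simp add: diag_sq_def sum.distrib)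
qed

lemma diag_antidiag_sq_givens_mult:
  assumes "mirror_givens n G" "M \<in> carrier_mat n n"
  shows "diag_sq (G * M) + antidiag_sq (G * M) = diag_sq M + antidiag_sq M"
proof -
  obtain a c s where G: "a < n" "a \<noteq> mirror n a" "c\<^sup>2 + s\<^sup>2 = 1" "G = givens n a c s"
    using assms by (auto simp: mirror_givens_def)
  note row = index_givens_mult[OF G(1,2) assms(2)]
  \<comment> \<open>A plane rotation preserves the Euclidean norm of the vector
    \<open>(x, y)\<close>.\<close>
  have rot: "(c * x - s * y)\<^sup>2 + (s * x + c * y)\<^sup>2 = x\<^sup>2 + y\<^sup>2" for x y
  proof -
    have "(c * x - s * y)\<^sup>2 + (s * x + c * y)\<^sup>2 = (c\<^sup>2 + s\<^sup>2) * (x\<^sup>2 + y\<^sup>2)"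
      by (simp add: power2_eq_square algebra_simps)
    with G(3) show ?thesis by simp
  qed
  have "((G * M) $$ (j, j))\<^sup>2 + ((G * M) $$ (mirror n j, j))\<^sup>2 =
    (M $$ (j, j))\<^sup>2 + (M $$ (mirror n j, j))\<^sup>2" if j: "j < n" for j
  proof -
    consider "j = a" | "j = mirror n a" | "j \<noteq> a" "j \<noteq> mirror n a" by blast
    then show ?thesis
    proof cases
      case 1
      then show ?thesis
        using G(2,4) j rot by (simp add: row mirror_less)
    next
      \<comment> \<open>Here \<open>mirror n j = a\<close>, so the two squares of the summand occur
        in the order opposite to that in \<open>rot\<close>.\<close>
      case 2
      then show ?thesis
        using G(1,2,4) j rot[of "M $$ (a, j)" "M $$ (j, j)"]
        by (simp add: row mirror_less mirror_mirror add.commute)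
    next
      \<comment> \<open>Both rows are untouched. For odd \<open>n\<close> the central index
        \<open>j = mirror n j\<close> always lands here, since the rotated pair consists of two
        distinct indices; its square is counted twice on both sides.\<close>
      case 3
      then show ?thesis
        using G(1,4) j by (simp add: row mirror_less mirror_eq_iff mirror_mirror)
    qed
  qed
  moreover have "G * M \<in> carrier_mat n n"
    using mirror_givens_carrier[OF assms(1)] assms(2) by simp
  ultimately show ?thesis
    using assms(2) by (simp add: diag_antidiag_sq_columns)
qed

lemma diag_antidiag_sq_mult_givens:
  assumes "mirror_givens n G" "M \<in> carrier_mat n n"
  shows "diag_sq (M * G) + antidiag_sq (M * G) = diag_sq M + antidiag_sq M"
proof -
  have G: "G \<in> carrier_mat n n" by (rule mirror_givens_carrier[OF assms(1)])
  have "transpose_mat (M * G) = transpose_mat G * transpose_mat M"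
    using assms(2) G by (rule transpose_mult)
  then show ?thesis
    using diag_antidiag_sq_givens_mult[OF mirror_givens_transpose[OF assms(1)], of "transpose_mat M"]
      diag_sq_transpose[of "M * G" n] antidiag_sq_transpose[of "M * G" n]
      diag_sq_transpose[of M n] antidiag_sq_transpose[of M n] assms(2) G
    by simp
qed

lemma mat_prod_list_carrier:
  "\<forall>G\<in>set Gs. mirror_givens n G \<Longrightarrow> mat_prod_list n Gs \<in> carrier_mat n n"
  by (induction Gs) (auto simp: mat_prod_list_def intro!: mult_carrier_mat dest: mirror_givens_carrier)

lemma mat_prod_list_Cons: "mat_prod_list n (G # Gs) = G * mat_prod_list n Gs"
  by (simp add: mat_prod_list_def)

lemma mat_prod_list_orthogonal:
  assumes "\<forall>G\<in>set Gs. mirror_givens n G"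
  shows "mat_prod_list n Gs * transpose_mat (mat_prod_list n Gs) = 1\<^sub>m n"
  using assms
proof (induction Gs)
  case Nil
  then show ?case by (simp add: mat_prod_list_def)
next
  case (Cons G Gs)
  let ?P = "mat_prod_list n Gs"
  have c: "G \<in> carrier_mat n n" "?P \<in> carrier_mat n n"
    using Cons.prems mirror_givens_carrier mat_prod_list_carrier by auto
  \<comment> \<open>Regrouping puts \<open>?P * transpose_mat ?P\<close> in the middle, which the
    induction hypothesis turns into the identity.\<close>
  have "(G * ?P) * transpose_mat (G * ?P) = G * (?P * transpose_mat ?P) * transpose_mat G"
    using c by (simp add: transpose_mult[OF c] assoc_mult_mat[of _ n n _ n _ n])
  also have "\<dots> = 1\<^sub>m n"
    using Cons c by (simp add: mirror_givens_orthogonal)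
  finally show ?case by (simp add: mat_prod_list_Cons)
qed

lemma diag_antidiag_sq_mat_prod_list_mult:
  assumes "\<forall>G\<in>set Gs. mirror_givens n G" "M \<in> carrier_mat n n"
  shows "diag_sq (mat_prod_list n Gs * M) + antidiag_sq (mat_prod_list n Gs * M) =
    diag_sq M + antidiag_sq M"
  using assms
proof (induction Gs)
  case Nil
  then show ?case by (simp add: mat_prod_list_def)
next
  case (Cons G Gs)
  let ?P = "mat_prod_list n Gs"
  have c: "G \<in> carrier_mat n n" "?P \<in> carrier_mat n n"
    using Cons.prems mirror_givens_carrier mat_prod_list_carrier by auto
  have "G * ?P * M = G * (?P * M)" "?P * M \<in> carrier_mat n n"
    using c Cons.prems by (auto intro: assoc_mult_mat)
  then show ?case
    using Cons diag_antidiag_sq_givens_mult[of n G "?P * M"] by (simp add: mat_prod_list_Cons)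
qed

lemma diag_antidiag_sq_mult_mat_prod_list:
  assumes "\<forall>H\<in>set Hs. mirror_givens n H" "M \<in> carrier_mat n n"
  shows "diag_sq (M * mat_prod_list n Hs) + antidiag_sq (M * mat_prod_list n Hs) =
    diag_sq M + antidiag_sq M"
  using assms
\<comment> \<open>The head of \<open>Hs\<close> acts on \<open>M\<close> first, so the induction
  hypothesis is needed at \<open>M * H\<close>; for left factors the head acts last and
  \<open>M\<close> can stay fixed.\<close>
proof (induction Hs arbitrary: M)
  case Nil
  then show ?case by (simp add: mat_prod_list_def)
next
  case (Cons H Hs)
  let ?P = "mat_prod_list n Hs"
  have c: "H \<in> carrier_mat n n" "?P \<in> carrier_mat n n"
    using Cons.prems mirror_givens_carrier mat_prod_list_carrier by auto
  have "M * (H * ?P) = M * H * ?P" "M * H \<in> carrier_mat n n"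
    using c Cons.prems by (auto intro: assoc_mult_mat[symmetric])
  then show ?case
    using Cons diag_antidiag_sq_mult_givens[of n H M] by (simp add: mat_prod_list_Cons)
qed

theorem corollary3p2:
  fixes n :: nat and \<gamma> :: real and M N :: "real mat" and Gs Hs :: "real mat list"
  assumes "n \<ge> 1"
    and "euler_magic UNIV n \<gamma> M"
    and "\<forall>G\<in>set Gs. mirror_givens n G"
    and "\<forall>H\<in>set Hs. mirror_givens n H"
    and "N = mat_prod_list n Gs * M * mat_prod_list n Hs"
  shows "N * transpose_mat N = \<gamma> \<cdot>\<^sub>m 1\<^sub>m n
    \<and> diag_sq N + antidiag_sq N = 2 * \<gamma>
    \<and> (euler_magic UNIV n \<gamma> N \<longleftrightarrow> diag_sq N = antidiag_sq N)"
proof -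
  let ?P = "mat_prod_list n Gs" and ?Q = "mat_prod_list n Hs"
  have M: "M \<in> carrier_mat n n" "M * transpose_mat M = \<gamma> \<cdot>\<^sub>m 1\<^sub>m n"
    "diag_sq M = \<gamma>" "antidiag_sq M = \<gamma>" "\<gamma> \<noteq> 0"
    using assms(2) by (auto simp: euler_magic_def)
  have P: "?P \<in> carrier_mat n n" and Q: "?Q \<in> carrier_mat n n"
    using assms mat_prod_list_carrier by auto
  have PM: "?P * M \<in> carrier_mat n n" using P M by simp
  have N: "N \<in> carrier_mat n n" using assms(5) PM Q by simp
  have "transpose_mat N = transpose_mat ?Q * (transpose_mat M * transpose_mat ?P)"
    by (simp add: assms(5) transpose_mult[OF PM Q] transpose_mult[OF P M(1)])
  \<comment> \<open>The factors are nested so that orthogonality of \<open>?Q\<close>, the equation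
    for \<open>M\<close> and orthogonality of \<open>?P\<close> can be used from the inside
    outwards.\<close>
  then have "N * transpose_mat N =
    ?P * (M * (?Q * transpose_mat ?Q) * transpose_mat M) * transpose_mat ?P"
    using P Q M(1) by (simp add: assms(5) assoc_mult_mat[of _ n n _ n _ n])
  also have "\<dots> = ?P * (\<gamma> \<cdot>\<^sub>m 1\<^sub>m n) * transpose_mat ?P"
    using M(1,2) by (simp add: mat_prod_list_orthogonal[OF assms(4)])
  also have "\<dots> = \<gamma> \<cdot>\<^sub>m (?P * transpose_mat ?P)"
    using P by (simp add: mult_smult_distrib[of _ n n _ n] mult_smult_assoc_mat[of _ n n _ n])
  also have "\<dots> = \<gamma> \<cdot>\<^sub>m 1\<^sub>m n"
    by (simp add: mat_prod_list_orthogonal[OF assms(3)])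
  finally have orth: "N * transpose_mat N = \<gamma> \<cdot>\<^sub>m 1\<^sub>m n" .
  \<comment> \<open>The right factors are removed first, with \<open>?P * M\<close> as the base
    matrix, and then the left ones.\<close>
  have "diag_sq N + antidiag_sq N = diag_sq (?P * M) + antidiag_sq (?P * M)"
    unfolding assms(5) using assms(4) PM by (rule diag_antidiag_sq_mult_mat_prod_list)
  also have "\<dots> = 2 * \<gamma>"
    using diag_antidiag_sq_mat_prod_list_mult[OF assms(3) M(1)] M by simp
  finally have sum: "diag_sq N + antidiag_sq N = 2 * \<gamma>" .
  \<comment> \<open>Two equal numbers with sum \<open>2 * \<gamma>\<close> are both
    \<open>\<gamma>\<close>; the other conditions hold for \<open>N\<close> by \<open>orth\<close>,
    its dimensions and \<open>\<gamma> \<noteq> 0\<close>.\<close>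
  have "euler_magic UNIV n \<gamma> N \<longleftrightarrow> diag_sq N = antidiag_sq N"
    using orth sum N M(5) assms(1) by (auto simp: euler_magic_def real_subring_def)
  with orth sum show ?thesis by blast
qed

end
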